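(* Let $k\ge d\ge 3$ and $t\ge 2$ be fixed integers. Then \[ g(n,k,d,t)=f(n,k,d,1) \] holds for all sufficiently large $n$ (depending on $k,d,t$).
   Context: $[n]=\{1,\dots,n\}$, and $\binom{V}{k}$ is the collection of all $k$-element subsets of a set $V$. A $d$-cluster of $k$-sets is a collection of $d$ different $k$-sets $A_1,\dots,A_d$ with $|A_1\cup\dots\cup A_d|\le 2k$ and $A_1\cap\dots\cap A_d=\emptyset$. A family $\mathcal{F}\subset\binom{[n]}{k}$ is $d$-cluster-free if it contains no $d$-cluster. The matching number $\nu(\mathcal{F})$ is the maximum number of pairwise disjoint sets in $\mathcal{F}$. $f(n,k,d,1)$ is the maximum size of a $d$-cluster-free family $\mathcal{F}\subset\binom{[n]}{k}$ with matching number at least $2$ (i.e. $\mathcal{F}$ is not intersecting). $g(n,k,d,t)$ is the maximum size of a family $\mathcal{F}\subset\binom{[n]}{k}$ that is $d$-cluster-free but not $t$-wise intersecting, i.e. for all distinct $A_1,\dots,A_d\in\mathcal{F}$ we have $A_1\cap\dots\cap A_d\ne\emptyset$ whenever $|A_1\cup\dots\cup A_d|\le 2k$, but there exist sets $A'_1,\dots,A'_t\in\mathcal{F}$ with $A'_1\cap\dots\cap A'_t=\emptyset$. *)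

theory Defs
  imports Main "HOL-Library.Disjoint_Sets" "HOL-Library.Ramsey"
begin

(* nsets V k is the collection of all (finite) k-element subsets of V. *)

definition cluster :: "nat \<Rightarrow> nat \<Rightarrow> 'a set set \<Rightarrow> bool" where
  "cluster k d C \<longleftrightarrow> C \<subseteq> nsets UNIV k \<and> card C = d \<and> card (\<Union>C) \<le> 2 * k \<and> \<Inter>C = {}"

definition cluster_free :: "nat \<Rightarrow> nat \<Rightarrow> 'a set set \<Rightarrow> bool" where
  "cluster_free k d F \<longleftrightarrow> \<not> (\<exists>C\<subseteq>F. cluster k d C)"

(* Intended for finite families F, where the maximum is over a finite set containing 0. *)
definition matching_number :: "'a set set \<Rightarrow> nat" where
  "matching_number F = Max {card M | M. M \<subseteq> F \<and> disjoint M}"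

(* The t sets are not required to be distinct. *)
definition wise_intersecting :: "nat \<Rightarrow> 'a set set \<Rightarrow> bool" where
  "wise_intersecting t F \<longleftrightarrow>
     (\<forall>A :: nat \<Rightarrow> 'a set. (\<forall>i\<in>{1..t}. A i \<in> F) \<longrightarrow> (\<Inter>i\<in>{1..t}. A i) \<noteq> {})"

(* The maxima below are over finite sets of naturals. If k \<ge> 1, d \<ge> 3, t \<ge> 2 and n \<ge> 2k, these
   sets are nonempty: a family of two disjoint k-sets is admissible in both. *)

(* The quantity f(n,k,d,1). *)
definition f_cluster1 :: "nat \<Rightarrow> nat \<Rightarrow> nat \<Rightarrow> nat" where
  "f_cluster1 n k d =
     Max {card F | F. F \<subseteq> nsets {1..n} k \<and> cluster_free k d F \<and> matching_number F \<ge> 2}"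

(* The quantity g(n,k,d,t). *)
definition g_cluster :: "nat \<Rightarrow> nat \<Rightarrow> nat \<Rightarrow> nat \<Rightarrow> nat" where
  "g_cluster n k d t =
     Max {card F | F. F \<subseteq> nsets {1..n} k \<and> cluster_free k d F \<and> \<not> wise_intersecting t F}"

end

theory Submission
  imports Defs Complex_Main
begin

text \<open>
  A family with two disjoint members is not \<open>t\<close>-wise intersecting, so only \<open>g \<le> f\<close> needs an
  argument. An intersecting family without a common point has only \<open>O(n ^ (k - 2))\<close> members: each
  member meets a fixed member \<open>A\<close> in some \<open>x\<close>, and meets a member avoiding \<open>x\<close> in a second
  point. On the other hand \<open>f\<close> has order at least \<open>n ^ (k - 1)\<close>: take a \<open>k\<close>-set \<open>A\<close> and all
  \<open>k\<close>-sets that contain a fixed point outside \<open>A\<close> and are disjoint from \<open>A\<close>. A cluster would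
  contain \<open>A\<close> and two further sets, whose union with \<open>A\<close> has more than \<open>2k\<close> points.
\<close>

text \<open>Deleting \<open>x\<close> and \<open>y\<close> maps these sets injectively to
  \<open>(k - 2)\<close>-subsets of \<open>V\<close>. Prescribing two points thus costs two factors
  of \<open>card V\<close>.\<close>

lemma card_nsets_insert2_le:
  assumes "finite V" "x \<noteq> y"
  shows "card {B \<in> nsets V k. x \<in> B \<and> y \<in> B} \<le> card V ^ (k - 2)"
proof -
  let ?S = "{B \<in> nsets V k. x \<in> B \<and> y \<in> B}"
  have inj: "inj_on (\<lambda>B. B - {x, y}) ?S"
    by (rule inj_onI) blast
  have "(\<lambda>B. B - {x, y}) ` ?S \<subseteq> nsets V (k - 2)"
    using assms by (auto simp: nsets_def card_Diff_subset)
  then have "card ?S \<le> card (nsets V (k - 2))"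
    by (rule card_inj_on_le[OF inj]) (simp add: assms finite_imp_finite_nsets)
  also have "\<dots> \<le> card V ^ (k - 2)"
    by (cases "k - 2 \<le> card V") (simp_all add: card_nsets binomial_le_pow binomial_eq_0)
  finally show ?thesis .
qed

lemma card_nontrivial_intersecting_le:
  assumes V: "finite V" and F: "F \<subseteq> nsets V k"
    and meet: "\<And>A B. A \<in> F \<Longrightarrow> B \<in> F \<Longrightarrow> A \<inter> B \<noteq> {}"
    and Int: "\<Inter>F = {}"
  shows "card F \<le> k * (k * card V ^ (k - 2))"
proof -
  have "F \<noteq> {}" using Int by auto
  then obtain A where A: "A \<in> F" by blast
  \<comment> \<open>Since \<open>B x\<close> avoids \<open>x\<close>, every \<open>y\<close> in
    \<open>B x\<close> differs from \<open>x\<close>, so each pair \<open>(x, y)\<close> really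
    prescribes two points. There are at most k * k such pairs with \<open>x\<close> in
    \<open>A\<close>.\<close>
  have "\<forall>x. \<exists>B\<in>F. x \<notin> B" using Int by blast
  then obtain B where B: "\<And>x. B x \<in> F" "\<And>x. x \<notin> B x" by metis
  have card: "finite C \<and> card C = k" if "C \<in> F" for C
    using F that by (auto simp: nsets_def)
  let ?S = "\<lambda>x y. {C \<in> nsets V k. x \<in> C \<and> y \<in> C}"
  have "F \<subseteq> (\<Union>x\<in>A. \<Union>y\<in>B x. ?S x y)"
  proof
    fix C assume C: "C \<in> F"
    obtain x where x: "x \<in> A" "x \<in> C" using meet[OF A C] by blast
    obtain y where "y \<in> B x" "y \<in> C" using meet[OF B(1)[of x] C] by blast
    then show "C \<in> (\<Union>x\<in>A. \<Union>y\<in>B x. ?S x y)" using x C F by blast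
  qed
  then have "card F \<le> card (\<Union>x\<in>A. \<Union>y\<in>B x. ?S x y)"
    using V A B card by (intro card_mono) (auto simp: finite_imp_finite_nsets)
  also have "\<dots> \<le> (\<Sum>x\<in>A. card (\<Union>y\<in>B x. ?S x y))"
    using A card by (intro card_UN_le) blast
  also have "\<dots> \<le> (\<Sum>x\<in>A. k * card V ^ (k - 2))"
  proof (rule sum_mono)
    fix x
    have "card (\<Union>y\<in>B x. ?S x y) \<le> (\<Sum>y\<in>B x. card (?S x y))"
      using B card by (intro card_UN_le) blast
    also have "\<dots> \<le> (\<Sum>y\<in>B x. card V ^ (k - 2))"
      using B V by (intro sum_mono card_nsets_insert2_le) metis+
    finally show "card (\<Union>y\<in>B x. ?S x y) \<le> k * card V ^ (k - 2)"
      using B card by simp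
  qed
  finally show ?thesis using A card by simp
qed

definition star_plus_set :: "'a set \<Rightarrow> nat \<Rightarrow> 'a \<Rightarrow> 'a set \<Rightarrow> 'a set set" where
  "star_plus_set V k v A = insert A {B \<in> nsets V k. v \<in> B \<and> B \<inter> A = {}}"

lemma two_distinct_members:
  assumes "2 \<le> card M"
  shows "\<exists>A\<in>M. \<exists>B\<in>M. A \<noteq> B"
proof -
  obtain T where "T \<subseteq> M" "card T = 2"
    using obtain_subset_with_card_n[OF assms] by blast
  then show ?thesis by (auto simp: card_2_iff)
qed

lemma cluster_free_star_plus_set:
  assumes A: "A \<in> nsets V k" and d: "d \<ge> 3"
  shows "cluster_free k d (star_plus_set V k v A)"
  unfolding cluster_free_def
proof (intro notI, elim exE conjE)
  fix C assume sub: "C \<subseteq> star_plus_set V k v A" and "cluster k d C"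
  then have C: "card C = d" "card (\<Union>C) \<le> 2 * k" "\<Inter>C = {}" "C \<subseteq> nsets UNIV k"
    by (auto simp: cluster_def)
  have "finite C" using C(1) d by (auto intro: card_ge_0_finite)
  then have "finite (\<Union>C)" using C(4) by (auto simp: nsets_def)
  have "A \<in> C"
  proof (rule ccontr)
    assume "A \<notin> C"
    then have "v \<in> \<Inter>C" using sub by (auto simp: star_plus_set_def)
    then show False using C(3) by simp
  qed
  \<comment> \<open>Here d \<ge> 3 enters: two members besides \<open>A\<close> remain. Being
    distinct sets of the same size \<open>k\<close>, they cover more than \<open>k\<close> points
    outside \<open>A\<close>.\<close>
  then have "card (C - {A}) \<ge> 2" using C(1) d \<open>finite C\<close> by simp
  from two_distinct_members[OF this]
  obtain B B' where B: "B \<in> C" "B' \<in> C" "B \<noteq> A" "B' \<noteq> A" "B \<noteq> B'"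
    by blast
  then have disj: "B \<inter> A = {}" "B' \<inter> A = {}" using sub by (auto simp: star_plus_set_def)
  have fin: "finite A" "finite B" "finite B'" and card: "card A = k" "card B = k" "card B' = k"
    using A B C(4) by (auto simp: nsets_def)
  have "\<not> B' \<subseteq> B" using B(5) fin card by (metis card_subset_eq)
  then have "card B < card (B \<union> B')" using fin by (intro psubset_card_mono) auto
  then have "2 * k < card (A \<union> (B \<union> B'))"
    using disj fin card by (subst card_Un_disjoint) auto
  also have "\<dots> \<le> card (\<Union>C)"
    using B \<open>A \<in> C\<close> by (intro card_mono \<open>finite (\<Union>C)\<close>) blast
  finally show False using C(2) by simp
qed

text \<open>Adding \<open>v\<close> to a \<open>(k - 1)\<close>-subset of
  \<open>V - insert v A\<close> gives a member of the family, and different subsets give different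
  members.\<close>

lemma card_star_plus_set_ge:
  assumes V: "finite V" and A: "A \<in> nsets V k" and v: "v \<in> V - A" and k: "k \<ge> 1"
  shows "card (star_plus_set V k v A) \<ge> (card V - k - 1) choose (k - 1)"
proof -
  let ?W = "V - insert v A"
  have A': "A \<subseteq> V" "finite A" "card A = k" using A by (auto simp: nsets_def)
  have "card ?W = card V - k - 1"
    using V A' v by (subst card_Diff_subset) auto
  moreover have "card (nsets ?W (k - 1)) \<le> card (star_plus_set V k v A)"
  proof (rule card_inj_on_le[where f = "insert v"])
    show "inj_on (insert v) (nsets ?W (k - 1))"
      by (rule inj_onI) (auto simp: nsets_def)
    show "insert v ` nsets ?W (k - 1) \<subseteq> star_plus_set V k v A"
    proof (rule image_subsetI)
      fix B assume B: "B \<in> nsets ?W (k - 1)"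
      then have "v \<notin> B" "insert v B \<inter> A = {}" using v by (auto simp: nsets_def)
      moreover from this have "insert v B \<in> nsets V k"
        using B v k by (auto simp: nsets_def)
      ultimately show "insert v B \<in> star_plus_set V k v A"
        by (simp add: star_plus_set_def)
    qed
    show "finite (star_plus_set V k v A)"
      using V by (auto simp: star_plus_set_def finite_imp_finite_nsets)
  qed
  ultimately show ?thesis by (simp add: card_nsets)
qed

text \<open>Reduces the matching number to a disjoint pair, so that its failure to reach 2 means
  pairwise intersecting. Excluding \<open>{}\<close> forces the two disjoint sets to be
  distinct.\<close>

lemma matching_number_ge_2_iff:
  assumes "finite F" "{} \<notin> F"
  shows "matching_number F \<ge> 2 \<longleftrightarrow> (\<exists>A\<in>F. \<exists>B\<in>F. A \<inter> B = {})"
proof -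
  have fin: "finite {card M | M. M \<subseteq> F \<and> disjoint M}"
    by (rule finite_subset[of _ "card ` Pow F"]) (use assms in auto)
  have ne: "{card M | M. M \<subseteq> F \<and> disjoint M} \<noteq> {}"
    by (auto intro: exI[of _ "{}"])
  have "matching_number F \<ge> 2 \<longleftrightarrow> (\<exists>M. M \<subseteq> F \<and> disjoint M \<and> 2 \<le> card M)"
    unfolding matching_number_def Max_ge_iff[OF fin ne] by blast
  also have "\<dots> \<longleftrightarrow> (\<exists>A\<in>F. \<exists>B\<in>F. A \<inter> B = {})"
  proof
    assume "\<exists>M. M \<subseteq> F \<and> disjoint M \<and> 2 \<le> card M"
    then obtain M where M: "M \<subseteq> F" "disjoint M" "2 \<le> card M" by blast
    then obtain A B where "A \<in> M" "B \<in> M" "A \<noteq> B"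
      by (blast dest: two_distinct_members)
    then show "\<exists>A\<in>F. \<exists>B\<in>F. A \<inter> B = {}" using M by (meson disjointD subset_iff)
  next
    assume "\<exists>A\<in>F. \<exists>B\<in>F. A \<inter> B = {}"
    then obtain A B where AB: "A \<in> F" "B \<in> F" "A \<inter> B = {}" by blast
    then have "A \<noteq> B" using assms(2) by auto
    then have "{A, B} \<subseteq> F \<and> disjoint {A, B} \<and> 2 \<le> card {A, B}"
      using AB by (auto simp: disjoint_def)
    then show "\<exists>M. M \<subseteq> F \<and> disjoint M \<and> 2 \<le> card M" by blast
  qed
  finally show ?thesis .
qed

text \<open>With m = n - k - 1, the binomial coefficient is at least (m / (k - 1)) ^ (k - 1), hence
  at least (n / (2k)) ^ (k - 1). This has one more factor n than the left side, and the first bound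
  on n lets that factor absorb the constants.\<close>

lemma choose_eventually_dominates:
  fixes k n :: nat
  assumes k: "k \<ge> 2" and n: "n \<ge> k * k * (2 * k) ^ (k - 1)" "n \<ge> 2 * k + 2"
  shows "k * (k * n ^ (k - 2)) \<le> (n - k - 1) choose (k - 1)"
proof -
  let ?m = "n - k - 1"
  have "(real n / (2 * real k)) ^ (k - 1) \<le> (real ?m / real (k - 1)) ^ (k - 1)"
  proof (rule power_mono)
    have "real n * real (k - 1) \<le> real ?m * (2 * real k)"
    proof -
      \<comment> \<open>The bound n \<ge> 2k + 2 is exactly n \<le> 2 * (n - k - 1).\<close>
      have "n * (k - 1) \<le> (2 * ?m) * k" using n(2) by (intro mult_mono) auto
      then have "real (n * (k - 1)) \<le> real ((2 * ?m) * k)" by (rule of_nat_mono)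
      then show ?thesis by simp
    qed
    then show "real n / (2 * real k) \<le> real ?m / real (k - 1)"
      using k by (simp add: divide_simps)
  qed simp
  also have "\<dots> \<le> real (?m choose (k - 1))"
    using n(2) binomial_ge_n_over_k_pow_k[of "k - 1" ?m, where 'a = real] by simp
  finally have "real n ^ (k - 1) \<le> real (?m choose (k - 1)) * (2 * real k) ^ (k - 1)"
    using k by (simp add: power_divide divide_simps)
  then have "real (n ^ (k - 1)) \<le> real ((?m choose (k - 1)) * (2 * k) ^ (k - 1))"
    by simp
  then have le: "n ^ (k - 1) \<le> (?m choose (k - 1)) * (2 * k) ^ (k - 1)"
    by (simp only: of_nat_le_iff)
  have "(k * (k * n ^ (k - 2))) * (2 * k) ^ (k - 1) = (k * k * (2 * k) ^ (k - 1)) * n ^ (k - 2)"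
    by (simp add: ac_simps)
  also have "\<dots> \<le> n * n ^ (k - 2)" using n(1) by (rule mult_right_mono) simp
  also have "\<dots> = n ^ (k - 1)" using k by (simp flip: power_Suc add: Suc_diff_Suc numeral_2_eq_2)
  also note le
  finally show ?thesis using k by simp
qed

theorem theorem1p10:
  fixes k d t :: nat
  assumes "k \<ge> d" and "d \<ge> 3" and "t \<ge> 2"
  shows "\<exists>N::nat. \<forall>n\<ge>N. g_cluster n k d t = f_cluster1 n k d"
proof (intro exI allI impI)
  fix n :: nat
  assume n: "n \<ge> max (k * k * (2 * k) ^ (k - 1)) (2 * k + 2)"
  have k: "k \<ge> 3" using assms by simp
  let ?V = "{1..n}"
  define P where "P F \<longleftrightarrow> F \<subseteq> nsets ?V k \<and> cluster_free k d F" for F :: "nat set set"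
  have finV: "finite (nsets ?V k)" by (simp add: finite_imp_finite_nsets)
  have fin: "finite F" and ne: "{} \<notin> F" if "P F" for F
    using that k finV by (auto simp: P_def nsets_def intro: finite_subset)
  note match = matching_number_ge_2_iff[OF fin ne]
  let ?f = "{card F | F. P F \<and> matching_number F \<ge> 2}"
  let ?g = "{card F | F. P F \<and> \<not> wise_intersecting t F}"
  have fg: "f_cluster1 n k d = Max ?f" "g_cluster n k d t = Max ?g"
    by (simp_all add: f_cluster1_def g_cluster_def P_def conj_assoc)
  have "finite {F. P F}"
    by (rule finite_subset[of _ "Pow (nsets ?V k)"]) (use finV in \<open>auto simp: P_def\<close>)
  then have finf: "finite ?f" and fing: "finite ?g"
    by simp_all
  have not_wise: "\<not> wise_intersecting t F" if F: "P F" "matching_number F \<ge> 2" for F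
  proof -
    obtain A B where AB: "A \<in> F" "B \<in> F" "A \<inter> B = {}" using F match by blast
    \<comment> \<open>The disjoint pair is padded to \<open>t\<close> sets by repeating
      \<open>B\<close>; as t \<ge> 2, both sets occur.\<close>
    let ?A = "\<lambda>i::nat. if i = 1 then A else B"
    have "(\<Inter>i\<in>{1..t}. ?A i) \<subseteq> ?A 1 \<inter> ?A 2"
      using assms(3) by (intro Int_greatest INT_lower) auto
    then have "(\<Inter>i\<in>{1..t}. ?A i) = {}" using AB by auto
    moreover have "\<forall>i\<in>{1..t}. ?A i \<in> F" using AB by simp
    ultimately show ?thesis unfolding wise_intersecting_def not_all
      by (intro exI[of _ ?A]) simp
  qed
  then have "?f \<subseteq> ?g" by blast
  define A where "A = {2..k + 1}"
  let ?F = "star_plus_set ?V k 1 A"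
  have A: "A \<in> nsets ?V k" using n by (auto simp: A_def nsets_def)
  then have PF: "P ?F"
    using cluster_free_star_plus_set[OF A assms(2)] by (auto simp: P_def star_plus_set_def)
  \<comment> \<open>A concrete member of the star at 1, with 1 + (k - 1) points, disjoint from
    \<open>A\<close>; it witnesses matching number at least 2.\<close>
  have "insert 1 {k + 2..2 * k} \<in> ?F"
    using n k by (auto simp: star_plus_set_def A_def nsets_def)
  moreover have "A \<in> ?F" "insert 1 {k + 2..2 * k} \<inter> A = {}"
    by (auto simp: star_plus_set_def A_def)
  ultimately have mF: "matching_number ?F \<ge> 2" using match[OF PF PF] by blast
  have "Max ?g \<le> Max ?f"
  proof (rule Max.boundedI[OF fing])
    show "?g \<noteq> {}" using PF mF not_wise by blast
    fix c assume "c \<in> ?g"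
    then obtain F where F: "P F" "\<not> wise_intersecting t F" "c = card F" by blast
    show "c \<le> Max ?f"
    \<comment> \<open>Either \<open>F\<close> itself is admissible for f, or it is intersecting. In
      the latter case it has no common point, since such a point would lie in any \<open>t\<close>
      members, so \<open>F\<close> is no larger than the star construction.\<close>
    proof (cases "matching_number F \<ge> 2")
      case True
      then show ?thesis using F by (intro Max_ge[OF finf]) blast
    next
      case False
      have "\<Inter>F = {}"
        using F(2) by (fastforce simp: wise_intersecting_def)
      then have "card F \<le> k * (k * card ?V ^ (k - 2))"
        using F(1) False match[OF F(1) F(1)]
        by (intro card_nontrivial_intersecting_le) (auto simp: P_def)
      also have "\<dots> \<le> (card ?V - k - 1) choose (k - 1)"
        using choose_eventually_dominates n k by simp
      also have "\<dots> \<le> card ?F"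
        using A n k by (intro card_star_plus_set_ge) (auto simp: A_def)
      also have "\<dots> \<le> Max ?f"
        using PF mF by (intro Max_ge[OF finf]) blast
      finally show ?thesis using F by simp
    qed
  qed
  moreover have "Max ?f \<le> Max ?g"
    using PF mF by (intro Max_mono \<open>?f \<subseteq> ?g\<close> fing) blast
  ultimately show "g_cluster n k d t = f_cluster1 n k d" by (simp add: fg)
qed

end
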